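(* Let $\mathcal{A}$ be a faithful Banach algebra and let $\varphi\in\Delta(\mathcal{A})$. Suppose that there is a topologically left invariant $\varphi$-mean of norm one on $\mathcal{A}^*$ and that $\overline{\langle \mathcal{A}\cdot I_{\varphi}\rangle}= I_{\varphi}$. Then the restriction map $R:\mathrm{TLIM}_{\varphi}(\mathcal{A}^{**})\rightarrow \mathrm{TLIM}_{\varphi}(\mathrm{LUC}(\mathcal{A}^* )^* )$, $m\mapsto m|_{\mathrm{LUC}(\mathcal{A}^* )}$, is a bijection.
   Context: A Banach algebra $\mathcal{A}$ is faithful if for each $a\in\mathcal{A}\setminus\{0\}$ there are $b,c\in\mathcal{A}$ with $ab\neq 0$ and $ca\neq 0$. $\Delta(\mathcal{A})$ is the set of characters (non-zero multiplicative linear functionals) of $\mathcal{A}$. $I_\varphi=\{a\in\mathcal{A}:\varphi(a)=0\}$, and $\overline{\langle\mathcal{A}\cdot I_\varphi\rangle}$ is the closed linear span in $\mathcal{A}$ of $\{ab:a\in\mathcal{A},b\in I_\varphi\}$. For $f\in\mathcal{A}^*$, $a,b\in\mathcal{A}$ put $\langle f\cdot a,b\rangle=\langle f,ab\rangle$. $\mathrm{LUC}(\mathcal{A}^* )$ is the norm closure in $\mathcal{A}^*$ of the linear span of $\{f\cdot a:f\in\mathcal{A}^*,a\in\mathcal{A}\}$. For a closed subspace $X\subseteq\mathcal{A}^*$ containing $\varphi$ with $X\cdot\mathcal{A}\subseteq X$, a topologically left invariant $\varphi$-mean on $X$ is an $m\in X^*$ with $m(\varphi)=1$ and $\langle m,f\cdot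 a\rangle=\varphi(a)\langle m,f\rangle$ for all $f\in X$, $a\in\mathcal{A}$. $\mathrm{TLIM}_\varphi(X^* )$ is the set of those with $\|m\|=1$ (used for $X=\mathcal{A}^*$ and $X=\mathrm{LUC}(\mathcal{A}^* )$). *)

theory Defs
  imports "HOL-Analysis.Analysis"
begin

section \<open>Complex Banach algebras\<close>

class complex_vector = real_vector +
  fixes scaleC :: "complex \<Rightarrow> 'a \<Rightarrow> 'a"  (infixr \<open>*\<^sub>C\<close> 75)
  assumes scaleC_add_right: "c *\<^sub>C (x + y) = c *\<^sub>C x + c *\<^sub>C y"
    and scaleC_add_left: "(c + d) *\<^sub>C x = c *\<^sub>C x + d *\<^sub>C x"
    and scaleC_scaleC: "c *\<^sub>C (d *\<^sub>C x) = (c * d) *\<^sub>C x"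
    and scaleC_one: "1 *\<^sub>C x = x"
    and scaleR_scaleC: "r *\<^sub>R x = complex_of_real r *\<^sub>C x"

global_interpretation complex_vector: vector_space "scaleC :: complex \<Rightarrow> 'a \<Rightarrow> 'a::complex_vector"
  by standard (simp_all add: scaleC_add_right scaleC_add_left scaleC_scaleC scaleC_one)

abbreviation cspan :: "'a::complex_vector set \<Rightarrow> 'a set"
  where "cspan \<equiv> module.span scaleC"

class complex_normed_vector = complex_vector + real_normed_vector +
  assumes norm_scaleC: "norm (c *\<^sub>C x) = cmod c * norm x"

text \<open>As with the library class \<^class>\<open>real_normed_algebra\<close>, no unit is assumed.\<close>

class complex_normed_algebra = complex_normed_vector + real_normed_algebra +
  assumes mult_scaleC_left: "(c *\<^sub>C x) * y = c *\<^sub>C (x * y)"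
    and mult_scaleC_right: "x * (c *\<^sub>C y) = c *\<^sub>C (x * y)"

class complex_banach_algebra = complex_normed_algebra + banach

instantiation complex :: complex_normed_vector
begin
definition scaleC_complex :: "complex \<Rightarrow> complex \<Rightarrow> complex"
  where "scaleC_complex c z = c * z"
instance
  by standard (auto simp: scaleC_complex_def algebra_simps scaleR_conv_of_real norm_mult)
end

instantiation blinfun :: (real_normed_vector, complex_normed_vector) complex_vector
begin
lift_definition scaleC_blinfun :: "complex \<Rightarrow> 'a \<Rightarrow>\<^sub>L 'b \<Rightarrow> 'a \<Rightarrow>\<^sub>L 'b"
  is "\<lambda>c f x. c *\<^sub>C f x"
proof -
  fix c and f :: "'a \<Rightarrow> 'b" assume "bounded_linear f"
  moreover have "bounded_linear (\<lambda>y::'b. c *\<^sub>C y)"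
    by (rule bounded_linear_intro[where K = "cmod c"])
       (simp_all add: scaleC_add_right scaleR_scaleC scaleC_scaleC norm_scaleC mult.commute)
  ultimately show "bounded_linear (\<lambda>x. c *\<^sub>C f x)"
    using bounded_linear_compose by blast
qed
instance
  by standard (transfer; simp add: scaleC_add_right scaleC_add_left scaleC_scaleC scaleC_one
      scaleR_scaleC fun_eq_iff)+
end

instance blinfun :: (real_normed_vector, complex_normed_vector) complex_normed_vector
proof
  fix c :: complex and f :: "'a \<Rightarrow>\<^sub>L 'b"
  have le: "norm (c *\<^sub>C f) \<le> cmod c * norm f" for c and f :: "'a \<Rightarrow>\<^sub>L 'b"
    by (rule norm_blinfun_bound)
       (auto simp: scaleC_blinfun.rep_eq norm_scaleC mult.assoc intro!: mult_left_mono norm_blinfun)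
  show "norm (c *\<^sub>C f) = cmod c * norm f"
  proof (cases "c = 0")
    case False
    have "norm f = norm (inverse c *\<^sub>C (c *\<^sub>C f))"
      using False by (simp add: scaleC_scaleC scaleC_one)
    also have "\<dots> \<le> norm (c *\<^sub>C f) / cmod c"
      using le[of "inverse c" "c *\<^sub>C f"] by (simp only: norm_inverse divide_inverse mult.commute)
    finally show ?thesis using le[of c f] False by (simp add: field_simps)
  qed (use le[of c f] in auto)
qed

definition clinear_on :: "'a::complex_vector set \<Rightarrow> ('a \<Rightarrow> complex) \<Rightarrow> bool"
  where "clinear_on X f \<longleftrightarrow>
    (\<forall>x\<in>X. \<forall>y\<in>X. f (x + y) = f x + f y) \<and> (\<forall>c. \<forall>x\<in>X. f (c *\<^sub>C x) = c * f x)"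

definition faithful_algebra :: "'a::complex_normed_algebra itself \<Rightarrow> bool"
  where "faithful_algebra _ \<longleftrightarrow> (\<forall>a::'a. a \<noteq> 0 \<longrightarrow> (\<exists>b c. a * b \<noteq> 0 \<and> c * a \<noteq> 0))"


section \<open>Characters\<close>

definition characters :: "('a::complex_normed_algebra \<Rightarrow> complex) set"
  where "characters = {\<phi>. clinear_on UNIV \<phi> \<and> (\<forall>a b. \<phi> (a * b) = \<phi> a * \<phi> b) \<and> (\<exists>a. \<phi> a \<noteq> 0)}"

definition char_ideal :: "('a \<Rightarrow> complex) \<Rightarrow> 'a set"
  where "char_ideal \<phi> = {a. \<phi> a = 0}"


section \<open>The dual space and its submodules\<close>

text \<open>The dual of a complex normed space consists of the complex-linear elements of
  the space of real-linear bounded maps into the complex numbers; its norm is the operator norm.\<close>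

definition cdual :: "('a::complex_normed_vector \<Rightarrow>\<^sub>L complex) set"
  where "cdual = {f. clinear_on UNIV (blinfun_apply f)}"

lift_definition dual_act :: "('a::real_normed_algebra \<Rightarrow>\<^sub>L complex) \<Rightarrow> 'a \<Rightarrow> ('a \<Rightarrow>\<^sub>L complex)"
    (infixl \<open>\<cdot>\<close> 70)
  is "\<lambda>f a b. f (a * b)"
  by (rule bounded_linear_compose[OF _ bounded_linear_mult_right])

text \<open>The closure below is taken in the space of all real-linear bounded maps; as
  \<^const>\<open>cdual\<close> is closed there, this is the closure in the dual (see \<open>LUC_subset_cdual\<close>).\<close>

definition LUC :: "('a::complex_normed_algebra \<Rightarrow>\<^sub>L complex) set"
  where "LUC = closure (cspan {f \<cdot> a | f a. f \<in> cdual})"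

text \<open>The dual of a subspace \<open>X\<close> of \<^const>\<open>cdual\<close>. Its elements are made unique as functions
  by requiring them to be \<^const>\<open>undefined\<close> outside \<open>X\<close>.\<close>

definition dual_on :: "'a::complex_normed_vector set \<Rightarrow> ('a \<Rightarrow> complex) set"
  where "dual_on X = {m \<in> extensional X. clinear_on X m \<and> (\<exists>K. \<forall>f\<in>X. cmod (m f) \<le> K * norm f)}"

definition dual_norm :: "'a::complex_normed_vector set \<Rightarrow> ('a \<Rightarrow> complex) \<Rightarrow> real"
  where "dual_norm X m = (SUP f\<in>{f \<in> X. norm f \<le> 1}. cmod (m f))"

text \<open>Characters are not assumed continuous. On a Banach algebra they are (lemma
  \<open>character_bounded_linear\<close> below), so that \<^term>\<open>Blinfun \<phi>\<close> is \<open>\<phi>\<close> as an element of the dual.\<close>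

definition topologically_left_invariant_mean ::
    "('a::complex_normed_algebra \<Rightarrow> complex) \<Rightarrow> ('a \<Rightarrow>\<^sub>L complex) set \<Rightarrow>
      (('a \<Rightarrow>\<^sub>L complex) \<Rightarrow> complex) \<Rightarrow> bool"
  where "topologically_left_invariant_mean \<phi> X m \<longleftrightarrow>
    m \<in> dual_on X \<and> m (Blinfun \<phi>) = 1 \<and> (\<forall>f\<in>X. \<forall>a. m (f \<cdot> a) = \<phi> a * m f)"

definition TLIM :: "('a::complex_normed_algebra \<Rightarrow> complex) \<Rightarrow> ('a \<Rightarrow>\<^sub>L complex) set \<Rightarrow>
      (('a \<Rightarrow>\<^sub>L complex) \<Rightarrow> complex) set"
  where "TLIM \<phi> X = {m. topologically_left_invariant_mean \<phi> X m \<and> dual_norm X m = 1}"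


section \<open>Well-definedness\<close>

lemma character_norm_le:
  fixes \<phi> :: "'a::complex_banach_algebra \<Rightarrow> complex"
  assumes "\<phi> \<in> characters"
  shows "cmod (\<phi> a) \<le> norm a"
proof (rule ccontr)
  assume "\<not> ?thesis"
  then have gt: "norm a < cmod (\<phi> a)" by simp
  have add: "\<phi> (x + y) = \<phi> x + \<phi> y" and scale: "\<phi> (c *\<^sub>C x) = c * \<phi> x"
    and mult: "\<phi> (x * y) = \<phi> x * \<phi> y" for x y c
    using assms by (auto simp: characters_def clinear_on_def)
  define x where "x = inverse (\<phi> a) *\<^sub>C a"
  have nz: "\<phi> a \<noteq> 0" using gt by auto
  have \<phi>x: "\<phi> x = 1" using nz by (simp add: x_def scale)
  have nx: "norm x < 1" using gt nz by (simp add: x_def norm_scaleC norm_divide inverse_eq_divide)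
  define p where "p = rec_nat x (\<lambda>_. (*) x)"
  have p0: "p 0 = x" and pS: "p (Suc n) = x * p n" for n by (simp_all add: p_def)
  have bound: "norm (p n) \<le> norm x ^ n" for n
  proof (induction n)
    case (Suc n)
    have "norm (p (Suc n)) \<le> norm x * norm (p n)" by (simp add: pS norm_mult_ineq)
    also have "\<dots> \<le> norm x * norm x ^ n" using Suc by (intro mult_left_mono) auto
    finally show ?case by simp
  qed (use nx in \<open>simp add: p0\<close>)
  have sm: "summable p"
    by (rule summable_comparison_test'[OF summable_geometric[of "norm x"], of 0])
       (use nx bound in auto)
  have "suminf p = x + x * suminf p"
    using suminf_split_head[OF sm] suminf_mult[OF sm, of x] by (simp add: p0 pS)
  then have "\<phi> (suminf p) = 1 + \<phi> (suminf p)" by (metis add mult \<phi>x mult_1)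
  then show False by simp
qed

lemma character_bounded_linear:
  fixes \<phi> :: "'a::complex_banach_algebra \<Rightarrow> complex"
  assumes "\<phi> \<in> characters"
  shows "bounded_linear \<phi>"
  using assms character_norm_le[OF assms]
  by (intro bounded_linear_intro[where K = 1])
     (auto simp: characters_def clinear_on_def scaleR_scaleC scaleC_complex_def)

lemma Blinfun_character_mem_cdual:
  fixes \<phi> :: "'a::complex_banach_algebra \<Rightarrow> complex"
  assumes "\<phi> \<in> characters"
  shows "Blinfun \<phi> \<in> cdual"
  using assms character_bounded_linear[OF assms]
  by (auto simp: cdual_def characters_def bounded_linear_Blinfun_apply)

lemma closed_cdual: "closed (cdual :: ('a::complex_normed_vector \<Rightarrow>\<^sub>L complex) set)"
proof -
  have "cdual = (\<Inter>c. \<Inter>x::'a. {f. blinfun_apply f (c *\<^sub>C x) = c * blinfun_apply f x})"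
    by (auto simp: cdual_def clinear_on_def blinfun.add_right)
  also have "closed \<dots>"
    by (intro closed_INT ballI closed_Collect_eq continuous_intros)
  finally show ?thesis .
qed

lemma dual_act_mem_cdual: "f \<in> cdual \<Longrightarrow> f \<cdot> a \<in> cdual"
  for a :: "'a::complex_normed_algebra"
  by (simp add: cdual_def clinear_on_def dual_act.rep_eq distrib_left mult_scaleC_right)

lemma subspace_cdual: "module.subspace scaleC cdual"
  by (rule complex_vector.subspaceI)
     (auto simp: cdual_def clinear_on_def blinfun.add_left scaleC_blinfun.rep_eq
       scaleC_complex_def algebra_simps)

lemma LUC_subset_cdual: "LUC \<subseteq> cdual"
  unfolding LUC_def
  by (intro closure_minimal closed_cdual complex_vector.span_minimal subspace_cdual)
     (auto intro: dual_act_mem_cdual)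

lemma Blinfun_character_mem_LUC:
  fixes \<phi> :: "'a::complex_banach_algebra \<Rightarrow> complex"
  assumes "\<phi> \<in> characters"
  shows "Blinfun \<phi> \<in> LUC"
proof -
  obtain a where a: "\<phi> a \<noteq> 0" using assms by (auto simp: characters_def)
  define b where "b = inverse (\<phi> a) *\<^sub>C a"
  have "\<phi> b = 1" using assms a by (simp add: b_def characters_def clinear_on_def)
  then have "Blinfun \<phi> \<cdot> b = Blinfun \<phi>"
    using assms character_bounded_linear[OF assms]
    by (intro blinfun_eqI) (simp add: dual_act.rep_eq bounded_linear_Blinfun_apply characters_def)
  then have "Blinfun \<phi> \<in> {f \<cdot> a | f a. f \<in> cdual}"
    using Blinfun_character_mem_cdual[OF assms] by (metis (mono_tags, lifting) mem_Collect_eq)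
  then show ?thesis
    unfolding LUC_def by (meson closure_subset complex_vector.span_base subsetD)
qed

lemma dual_act_mem_LUC: "f \<in> LUC \<Longrightarrow> f \<cdot> a \<in> LUC"
  unfolding LUC_def
  by (rule subsetD[OF closure_subset], rule complex_vector.span_base)
     (use LUC_subset_cdual in \<open>auto simp: LUC_def\<close>)

end

(* For b in I_\<phi> and a mean m on LUC, m (f \<cdot> (a * b)) = m ((f \<cdot> a) \<cdot> b) = 0. As A I_\<phi> spans a dense
   subspace of I_\<phi>, the functional a \<mapsto> m (f \<cdot> a) kills I_\<phi>, so it is a multiple of \<phi>, even when f is
   not in LUC. Hence f \<mapsto> m (f \<cdot> u) does not depend on the choice of u with \<phi> u = 1 and extends m to an
   invariant mean on the whole dual. A mean of norm one forces \<phi> to have norm one, so u may be taken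
   of norm arbitrarily close to 1 and the extension has norm one as well. *)
theory Submission
  imports Defs
begin

section \<open>Characters: contractivity and almost normalized vectors\<close>

lemma characterD:
  assumes "\<phi> \<in> characters"
  shows character_add: "\<phi> (x + y) = \<phi> x + \<phi> y"
    and character_scaleC: "\<phi> (c *\<^sub>C x) = c * \<phi> x"
    and character_mult: "\<phi> (x * y) = \<phi> x * \<phi> y"
  using assms by (auto simp: characters_def clinear_on_def)

lemma character_diff: "\<phi> \<in> characters \<Longrightarrow> \<phi> (x - y) = \<phi> x - \<phi> y"
  using character_add[of \<phi> "x - y" y] by simp

lemma norm_Blinfun_character_le:
  fixes \<phi> :: "'a::complex_banach_algebra \<Rightarrow> complex"
  assumes "\<phi> \<in> characters"
  shows "norm (Blinfun \<phi>) \<le> 1"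
  using character_norm_le[OF assms] character_bounded_linear[OF assms]
  by (intro norm_blinfun_bound) (auto simp: bounded_linear_Blinfun_apply)

text \<open>If \<open>cmod (\<phi> x) \<le> norm x / (1 + e)\<close> held for every
  \<open>x\<close>, the norm of \<phi> would drop below one. A vector violating this bound is
  divided by its value under \<phi>.\<close>

lemma character_approx_unit_vector:
  fixes \<phi> :: "'a::complex_banach_algebra \<Rightarrow> complex"
  assumes \<phi>: "\<phi> \<in> characters" and norm: "norm (Blinfun \<phi>) \<ge> 1" and "e > 0"
  obtains u where "\<phi> u = 1" "norm u < 1 + e"
proof -
  have "\<exists>x. cmod (\<phi> x) > norm x / (1 + e)"
  proof (rule ccontr)
    assume "\<not> ?thesis"
    then have "norm (Blinfun \<phi>) \<le> 1 / (1 + e)"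
      using \<open>e > 0\<close> character_bounded_linear[OF \<phi>]
      by (intro norm_blinfun_bound) (auto simp: bounded_linear_Blinfun_apply not_less)
    also have "\<dots> < 1" using \<open>e > 0\<close> by simp
    finally show False using norm by simp
  qed
  then obtain x where x: "cmod (\<phi> x) > norm x / (1 + e)" by blast
  moreover have "norm x / (1 + e) \<ge> 0" using \<open>e > 0\<close> by simp
  ultimately have pos: "cmod (\<phi> x) > 0" by linarith
  have "norm x < (1 + e) * cmod (\<phi> x)"
    using x \<open>e > 0\<close> by (simp add: field_simps)
  then have "norm (inverse (\<phi> x) *\<^sub>C x) < 1 + e"
    using pos by (simp add: norm_scaleC norm_divide field_simps)
  moreover have "\<phi> (inverse (\<phi> x) *\<^sub>C x) = 1"
    using pos by (simp add: character_scaleC[OF \<phi>])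
  ultimately show ?thesis by (rule that[rotated])
qed

section \<open>The right action of the algebra on functionals\<close>

lemma dual_act_add_left: "(f + g) \<cdot> a = f \<cdot> a + g \<cdot> a"
  by (rule blinfun_eqI) (simp add: dual_act.rep_eq blinfun.add_left)

lemma dual_act_scaleC_left: "(c *\<^sub>C f) \<cdot> a = c *\<^sub>C (f \<cdot> a)"
  by (rule blinfun_eqI) (simp add: dual_act.rep_eq scaleC_blinfun.rep_eq)

lemma dual_act_add_right: "f \<cdot> (a + b) = f \<cdot> a + f \<cdot> b"
  by (rule blinfun_eqI) (simp add: dual_act.rep_eq blinfun.add_left blinfun.add_right distrib_right)

text \<open>The scalar has to pass through \<open>f\<close>, and an element of the function type is
  a priori only real-linear; \<open>cdual\<close> supplies complex linearity.\<close>

lemma dual_act_scaleC_right: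
  fixes a :: "'a::complex_normed_algebra"
  shows "f \<in> cdual \<Longrightarrow> f \<cdot> (c *\<^sub>C a) = c *\<^sub>C (f \<cdot> a)"
  by (rule blinfun_eqI)
     (simp add: dual_act.rep_eq scaleC_blinfun.rep_eq scaleC_complex_def mult_scaleC_left
       cdual_def clinear_on_def)

lemma dual_act_mult: "f \<cdot> (a * b) = (f \<cdot> a) \<cdot> b"
  by (rule blinfun_eqI) (simp add: dual_act.rep_eq mult.assoc)

lemma norm_dual_act_le: "norm (f \<cdot> a) \<le> norm f * norm a"
proof (rule norm_blinfun_bound)
  fix b
  have "norm (f (a * b)) \<le> norm f * norm (a * b)" by (rule norm_blinfun)
  also have "\<dots> \<le> norm f * (norm a * norm b)"
    by (intro mult_left_mono norm_mult_ineq) simp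
  finally show "norm ((f \<cdot> a) b) \<le> norm f * norm a * norm b"
    by (simp add: dual_act.rep_eq mult.assoc)
qed simp

section \<open>The subspace \<open>LUC\<close>\<close>

text \<open>A single action moves the whole dual into \<open>LUC\<close>, so
  \<open>m (f \<cdot> a)\<close> is meaningful for a mean \<open>m\<close> living on
  \<open>LUC\<close> alone.\<close>

lemma dual_act_cdual_mem_LUC: "f \<in> cdual \<Longrightarrow> f \<cdot> a \<in> LUC"
  unfolding LUC_def
  by (rule subsetD[OF closure_subset], rule complex_vector.span_base) auto

lemma scaleR_mem_cdual: "f \<in> cdual \<Longrightarrow> r *\<^sub>R f \<in> cdual"
  by (simp add: scaleR_scaleC complex_vector.subspace_scale[OF subspace_cdual])

lemma subspace_closure:
  fixes S :: "'a::complex_normed_vector set"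
  assumes S: "module.subspace scaleC S"
  shows "module.subspace scaleC (closure S)"
proof (rule complex_vector.subspaceI)
  show "0 \<in> closure S"
    using complex_vector.subspace_0[OF S] closure_subset by blast
  fix x y assume "x \<in> closure S" "y \<in> closure S"
  then obtain X Y where X: "\<And>n. X n \<in> S" "X \<longlonglongrightarrow> x" and Y: "\<And>n. Y n \<in> S" "Y \<longlonglongrightarrow> y"
    by (auto simp: closure_sequential)
  then show "x + y \<in> closure S"
    using complex_vector.subspace_add[OF S] tendsto_add[OF X(2) Y(2)]
    unfolding closure_sequential by (intro exI[of _ "\<lambda>n. X n + Y n"]) simp
next
  fix c and x assume "x \<in> closure S"
  then obtain X where X: "\<And>n. X n \<in> S" "X \<longlonglongrightarrow> x"
    by (auto simp: closure_sequential)
  have "bounded_linear (\<lambda>y::'a. c *\<^sub>C y)"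
    by (rule bounded_linear_intro[where K = "cmod c"])
       (simp_all add: scaleC_add_right scaleR_scaleC scaleC_scaleC norm_scaleC mult.commute)
  then have "(\<lambda>n. c *\<^sub>C X n) \<longlonglongrightarrow> c *\<^sub>C x"
    using X(2) by (rule bounded_linear.tendsto)
  then show "c *\<^sub>C x \<in> closure S"
    using X(1) complex_vector.subspace_scale[OF S]
    unfolding closure_sequential by (intro exI[of _ "\<lambda>n. c *\<^sub>C X n"]) simp
qed

lemma subspace_LUC: "module.subspace scaleC LUC"
  unfolding LUC_def by (intro subspace_closure complex_vector.subspace_span)

lemma scaleR_mem_LUC: "f \<in> LUC \<Longrightarrow> r *\<^sub>R f \<in> LUC"
  by (simp add: scaleR_scaleC complex_vector.subspace_scale[OF subspace_LUC])

section \<open>The dual norm and a pointwise description of means\<close>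

lemma cmod_le_dual_norm:
  assumes m: "m \<in> dual_on X" and X: "\<And>r f. f \<in> X \<Longrightarrow> r *\<^sub>R f \<in> X" and f: "f \<in> X"
  shows "cmod (m f) \<le> dual_norm X m * norm f"
proof -
  have scale: "m (c *\<^sub>C x) = c * m x" if "x \<in> X" for c x
    using m that by (auto simp: dual_on_def clinear_on_def)
  obtain K where K: "\<And>f. f \<in> X \<Longrightarrow> cmod (m f) \<le> K * norm f"
    using m by (auto simp: dual_on_def)
  show ?thesis
  proof (cases "f = 0")
    case True
    then show ?thesis using K[OF f] by simp
  next
    case False
    let ?g = "inverse (norm f) *\<^sub>R f"
    \<comment> \<open>The real supremum in \<open>dual_norm\<close> is an upper bound only once the
      set is known to be bounded. \<open>dual_on\<close> does not fix the sign of \<open>K\<close>,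
      hence the absolute value.\<close>
    have "bdd_above ((\<lambda>f. cmod (m f)) ` {f \<in> X. norm f \<le> 1})"
    proof (rule bdd_aboveI2)
      fix h assume h: "h \<in> {f \<in> X. norm f \<le> 1}"
      then have "cmod (m h) \<le> K * norm h" using K by blast
      also have "\<dots> \<le> \<bar>K\<bar> * 1" using h by (intro mult_mono) auto
      finally show "cmod (m h) \<le> \<bar>K\<bar>" by simp
    qed
    moreover have "?g \<in> {f \<in> X. norm f \<le> 1}" using X[OF f] False by simp
    ultimately have "cmod (m ?g) \<le> dual_norm X m"
      unfolding dual_norm_def by (rule cSUP_upper[rotated])
    moreover have "cmod (m ?g) = cmod (m f) / norm f"
      using scale[OF f] by (simp add: scaleR_scaleC norm_mult norm_inverse divide_inverse mult.commute)
    ultimately show ?thesis using False by (simp add: pos_divide_le_eq)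
  qed
qed

lemma dual_norm_eq_1:
  assumes le: "\<And>f. f \<in> X \<Longrightarrow> cmod (m f) \<le> norm f"
    and g: "g \<in> X" "norm g \<le> 1" "m g = 1"
  shows "dual_norm X m = 1"
  unfolding dual_norm_def
proof (rule cSup_eq_maximum)
  show "1 \<in> (\<lambda>f. cmod (m f)) ` {f \<in> X. norm f \<le> 1}"
    using g by (intro image_eqI[where x = g]) auto
qed (use le in \<open>force intro: order_trans\<close>)

text \<open>The point \<open>Blinfun \<phi>\<close> of the unit ball is sent to 1, so a contractive
  mean has norm exactly one. The pointwise bound passes to subspaces directly, unlike the
  supremum.\<close>

lemma TLIM_iff:
  fixes \<phi> :: "'a::complex_banach_algebra \<Rightarrow> complex"
  assumes \<phi>: "\<phi> \<in> characters" and mem: "Blinfun \<phi> \<in> X"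
    and X: "\<And>r f. f \<in> X \<Longrightarrow> r *\<^sub>R f \<in> X"
  shows "m \<in> TLIM \<phi> X \<longleftrightarrow> m \<in> extensional X \<and> clinear_on X m \<and> (\<forall>f\<in>X. cmod (m f) \<le> norm f) \<and>
    m (Blinfun \<phi>) = 1 \<and> (\<forall>f\<in>X. \<forall>a. m (f \<cdot> a) = \<phi> a * m f)" (is "_ \<longleftrightarrow> ?R")
proof
  assume "m \<in> TLIM \<phi> X"
  then have m: "topologically_left_invariant_mean \<phi> X m" "dual_norm X m = 1"
    by (auto simp: TLIM_def)
  then have "cmod (m f) \<le> norm f" if "f \<in> X" for f
    using cmod_le_dual_norm[OF _ X that, of m] by (simp add: topologically_left_invariant_mean_def)
  with m show ?R by (auto simp: topologically_left_invariant_mean_def dual_on_def)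
next
  assume R: ?R
  then have "dual_norm X m = 1"
    by (intro dual_norm_eq_1[OF _ mem norm_Blinfun_character_le[OF \<phi>]]) auto
  moreover have "\<exists>K. \<forall>f\<in>X. cmod (m f) \<le> K * norm f"
    using R by (intro exI[of _ 1]) simp
  ultimately show "m \<in> TLIM \<phi> X"
    using R by (simp add: TLIM_def topologically_left_invariant_mean_def dual_on_def)
qed

lemmas TLIM_cdual_iff = TLIM_iff[OF _ Blinfun_character_mem_cdual scaleR_mem_cdual]
lemmas TLIM_LUC_iff = TLIM_iff[OF _ Blinfun_character_mem_LUC scaleR_mem_LUC]

section \<open>Extending a mean from \<open>LUC\<close> to the dual\<close>

lemma mean_dual_act_char_ideal:
  fixes \<phi> :: "'a::complex_banach_algebra \<Rightarrow> complex"
  assumes \<phi>: "\<phi> \<in> characters" and m: "m \<in> TLIM \<phi> LUC" and f: "f \<in> cdual"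
    and dense: "closure (cspan {a * b | a b. b \<in> char_ideal \<phi>}) = char_ideal \<phi>"
    and b: "\<phi> b = 0"
  shows "m (f \<cdot> b) = 0"
proof -
  have add: "m (x + y) = m x + m y" if "x \<in> LUC" "y \<in> LUC" for x y
    using m that by (simp add: TLIM_LUC_iff[OF \<phi> \<phi>] clinear_on_def)
  have scale: "m (c *\<^sub>C x) = c * m x" and bound: "cmod (m x) \<le> norm x"
    and inv: "m (x \<cdot> a) = \<phi> a * m x" if "x \<in> LUC" for x c a
    using m that by (simp_all add: TLIM_LUC_iff[OF \<phi> \<phi>] clinear_on_def)
  note fL = dual_act_cdual_mem_LUC[OF f]
  have lin: "m (f \<cdot> (x + y)) = m (f \<cdot> x) + m (f \<cdot> y)" "m (f \<cdot> (c *\<^sub>C x)) = c * m (f \<cdot> x)" for x y c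
    by (simp_all add: dual_act_add_right dual_act_scaleC_right[OF f] add scale fL)
  \<comment> \<open>Continuity makes the kernel closed, so that vanishing on the span carries over
    to its closure.\<close>
  have "bounded_linear (\<lambda>x. m (f \<cdot> x))"
  proof (rule bounded_linear_intro[where K = "norm f"])
    show "norm (m (f \<cdot> x)) \<le> norm x * norm f" for x
      using bound[OF fL, of x] norm_dual_act_le[of f x] by (simp add: mult.commute)
  qed (simp_all add: lin scaleR_scaleC scaleC_complex_def)
  then have "continuous_on UNIV (\<lambda>x. m (f \<cdot> x))"
    by (rule linear_continuous_on)
  then have closed: "closed {x. m (f \<cdot> x) = 0}"
    by (intro closed_Collect_eq continuous_on_const)
  have "cspan {a * b | a b. b \<in> char_ideal \<phi>} \<subseteq> {x. m (f \<cdot> x) = 0}"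
  proof (rule complex_vector.span_minimal)
    \<comment> \<open>Invariance is applied to \<open>f \<cdot> a\<close>, which is in
      \<open>LUC\<close>, and yields the factor \<open>\<phi> b = 0\<close>.\<close>
    show "{a * b | a b. b \<in> char_ideal \<phi>} \<subseteq> {x. m (f \<cdot> x) = 0}"
      by (auto simp: dual_act_mult inv[OF fL] char_ideal_def)
    show "module.subspace (*\<^sub>C) {x. m (f \<cdot> x) = 0}"
      \<comment> \<open>The instance with scalar 0 puts the zero vector into the kernel.\<close>
      using lin(2)[of 0 0] by (intro complex_vector.subspaceI) (auto simp: lin)
  qed
  then have "char_ideal \<phi> \<subseteq> {x. m (f \<cdot> x) = 0}"
    using closure_minimal[OF _ closed] by (subst dense[symmetric]) blast
  then show ?thesis using b by (auto simp: char_ideal_def)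
qed

lemma mean_dual_act:
  fixes \<phi> :: "'a::complex_banach_algebra \<Rightarrow> complex"
  assumes \<phi>: "\<phi> \<in> characters" and m: "m \<in> TLIM \<phi> LUC" and f: "f \<in> cdual"
    and dense: "closure (cspan {a * b | a b. b \<in> char_ideal \<phi>}) = char_ideal \<phi>"
    and u: "\<phi> u = 1"
  shows "m (f \<cdot> a) = \<phi> a * m (f \<cdot> u)"
proof -
  note fL = dual_act_cdual_mem_LUC[OF f]
  have add: "m (f \<cdot> x + f \<cdot> y) = m (f \<cdot> x) + m (f \<cdot> y)" and scale: "m (c *\<^sub>C (f \<cdot> x)) = c * m (f \<cdot> x)"
    for x y c
    using m fL by (simp_all add: TLIM_LUC_iff[OF \<phi> \<phi>] clinear_on_def)
  \<comment> \<open>The component of \<open>a\<close> in the kernel of \<phi>, along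
    \<open>u\<close>.\<close>
  let ?b = "a - \<phi> a *\<^sub>C u"
  have "m (f \<cdot> ?b) = 0"
    using u by (intro mean_dual_act_char_ideal[OF \<phi> m f dense])
      (simp add: character_diff[OF \<phi>] character_scaleC[OF \<phi>])
  moreover have "m (f \<cdot> a) = m (f \<cdot> ?b) + m (f \<cdot> (\<phi> a *\<^sub>C u))"
    using add[of ?b "\<phi> a *\<^sub>C u"] dual_act_add_right[of f ?b "\<phi> a *\<^sub>C u"] by simp
  ultimately show ?thesis by (simp add: dual_act_scaleC_right[OF f] scale)
qed

lemma TLIM_LUC_extension:
  fixes \<phi> :: "'a::complex_banach_algebra \<Rightarrow> complex"
  assumes \<phi>: "\<phi> \<in> characters" and m: "m \<in> TLIM \<phi> LUC"
    and dense: "closure (cspan {a * b | a b. b \<in> char_ideal \<phi>}) = char_ideal \<phi>"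
    and u: "\<phi> u = 1"
  shows "(\<lambda>f\<in>cdual. m (f \<cdot> u)) \<in> TLIM \<phi> cdual" (is "?n \<in> _")
proof -
  note fL = dual_act_cdual_mem_LUC
  have add: "m (x + y) = m x + m y" if "x \<in> LUC" "y \<in> LUC" for x y
    using m that by (simp add: TLIM_LUC_iff[OF \<phi> \<phi>] clinear_on_def)
  have scale: "m (c *\<^sub>C x) = c * m x" and bound: "cmod (m x) \<le> norm x"
    and inv: "m (x \<cdot> a) = \<phi> a * m x" if "x \<in> LUC" for x c a
    using m that by (simp_all add: TLIM_LUC_iff[OF \<phi> \<phi>] clinear_on_def)
  have one: "m (Blinfun \<phi>) = 1" using m by (simp add: TLIM_LUC_iff[OF \<phi> \<phi>])
  note \<phi>L = Blinfun_character_mem_LUC[OF \<phi>] and \<phi>d = Blinfun_character_mem_cdual[OF \<phi>]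
  \<comment> \<open>The contraction \<open>m\<close> takes the value 1 at
    \<open>Blinfun \<phi>\<close>.\<close>
  have norm: "norm (Blinfun \<phi>) \<ge> 1" using bound[OF \<phi>L] by (simp add: one)
  have "clinear_on cdual ?n"
    by (auto simp: clinear_on_def add scale fL dual_act_add_left dual_act_scaleC_left
        complex_vector.subspace_add[OF subspace_cdual] complex_vector.subspace_scale[OF subspace_cdual])
  moreover have "cmod (?n f) \<le> norm f" if f: "f \<in> cdual" for f
  proof (rule field_le_epsilon)
    fix e :: real assume "e > 0"
    \<comment> \<open>The excess is chosen so that its product with \<open>norm f\<close> is at most
      \<open>e\<close>; adding 1 covers \<open>f = 0\<close>.\<close>
    then have "e / (norm f + 1) > 0" by (simp add: add_nonneg_pos)
    then obtain v where v: "\<phi> v = 1" "norm v < 1 + e / (norm f + 1)"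
      using character_approx_unit_vector[OF \<phi> norm] by metis
    \<comment> \<open>The fixed \<open>u\<close> may have large norm; it is exchanged for
      \<open>v\<close> at no cost, since both have value 1 under \<phi>.\<close>
    have "cmod (?n f) = cmod (m (f \<cdot> v))"
      using mean_dual_act[OF \<phi> m f dense u, of v] v f by simp
    also have "\<dots> \<le> norm f * norm v"
      using bound[OF fL[OF f], of v] norm_dual_act_le[of f v] by linarith
    also have "\<dots> \<le> norm f * (1 + e / (norm f + 1))"
      using v by (intro mult_left_mono) auto
    also have "\<dots> \<le> norm f + e"
      using \<open>e > 0\<close> by (simp add: field_simps add_pos_nonneg)
    finally show "cmod (?n f) \<le> norm f + e" .
  qed
  moreover have "?n (Blinfun \<phi>) = 1" using \<phi>d \<phi>L u one by (simp add: inv)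
  \<comment> \<open>As \<open>f\<close> may lie outside \<open>LUC\<close>, invariance of
    \<open>m\<close> cannot be applied to it; instead \<open>(f \<cdot> a) \<cdot> u\<close> is read
    as \<open>f \<cdot> (a * u)\<close>, where \<open>a * u\<close> has value
    \<open>\<phi> a\<close>.\<close>
  moreover have "?n (f \<cdot> a) = \<phi> a * ?n f" if f: "f \<in> cdual" for f a
    using mean_dual_act[OF \<phi> m f dense u, of "a * u"] f u
    by (simp add: dual_act_mem_cdual dual_act_mult character_mult[OF \<phi>])
  ultimately show ?thesis by (simp add: TLIM_cdual_iff[OF \<phi> \<phi>])
qed

theorem theorem3p4:
  fixes \<phi> :: "'a::complex_banach_algebra \<Rightarrow> complex"
  assumes "faithful_algebra TYPE('a)"
    and "\<phi> \<in> characters"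
    and "\<exists>m. topologically_left_invariant_mean \<phi> cdual m \<and> dual_norm cdual m = 1"
    and "closure (cspan {a * b | a b. b \<in> char_ideal \<phi>}) = char_ideal \<phi>"
  shows "bij_betw (\<lambda>m. restrict m LUC) (TLIM \<phi> cdual) (TLIM \<phi> LUC)"
proof -
  note \<phi> = assms(2) and sub = subsetD[OF LUC_subset_cdual]
  obtain a where a: "\<phi> a \<noteq> 0" using \<phi> by (auto simp: characters_def)
  define u where "u = inverse (\<phi> a) *\<^sub>C a"
  have u: "\<phi> u = 1" using a by (simp add: u_def character_scaleC[OF \<phi>])
  show ?thesis
  proof (rule bij_betw_byWitness[where f' = "\<lambda>m. \<lambda>f\<in>cdual. m (f \<cdot> u)"])
    \<comment> \<open>Invariance on the dual gives
      \<open>m (f \<cdot> u) = \<phi> u * m f = m f\<close>, so the values on \<open>LUC\<close>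
      determine \<open>m\<close>.\<close>
    show "\<forall>m\<in>TLIM \<phi> cdual. (\<lambda>f\<in>cdual. restrict m LUC (f \<cdot> u)) = m"
      using u by (auto simp: TLIM_cdual_iff[OF \<phi> \<phi>] dual_act_cdual_mem_LUC
          fun_eq_iff restrict_def extensional_def)
    \<comment> \<open>The same computation, with invariance now available for \<open>f\<close> in
      \<open>LUC\<close>.\<close>
    show "\<forall>m\<in>TLIM \<phi> LUC. restrict (\<lambda>f\<in>cdual. m (f \<cdot> u)) LUC = m"
      using u by (auto simp: TLIM_LUC_iff[OF \<phi> \<phi>] sub
          fun_eq_iff restrict_def extensional_def)
    \<comment> \<open>\<open>LUC\<close> is stable under the action and contains
      \<open>Blinfun \<phi>\<close>, so every pointwise condition is inherited and the norm stays
      one.\<close>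
    show "(\<lambda>m. restrict m LUC) ` TLIM \<phi> cdual \<subseteq> TLIM \<phi> LUC"
    proof clarify
      fix m assume m: "m \<in> TLIM \<phi> cdual"
      then show "restrict m LUC \<in> TLIM \<phi> LUC"
        by (auto simp: TLIM_cdual_iff[OF \<phi> \<phi>] TLIM_LUC_iff[OF \<phi> \<phi>] sub clinear_on_def
            complex_vector.subspace_add[OF subspace_LUC] complex_vector.subspace_scale[OF subspace_LUC]
            dual_act_mem_LUC Blinfun_character_mem_LUC[OF \<phi>])
    qed
    show "(\<lambda>m. \<lambda>f\<in>cdual. m (f \<cdot> u)) ` TLIM \<phi> LUC \<subseteq> TLIM \<phi> cdual"
      using TLIM_LUC_extension[OF \<phi> _ assms(4) u] by blast
  qed
qed

end
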